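(* Let $(X,\mu,m)$ be a connected weighted graph which admits a compatible intrinsic metric $\rho$, let $o\in X$ be a fixed vertex and let $B_r=\{x\in X\mid \rho(x,o)\le r\}$, $r\ge 0$. Let $f:X\to[0,\infty)$ be a non-negative subharmonic function such that for some $p\in(1,\infty)$ $$\inf_{r_0>0}\int_{r_0}^{\infty}\frac{r}{\|f1_{B_r}\|_p^p}\,dr=\infty .$$ Then $f$ is constant.
   Context: Weighted graph: $X$ is a countable discrete set, $m:X\to(0,\infty)$ is extended additively to a measure on all subsets of $X$, and $\mu:X\times X\to[0,\infty)$, $(x,y)\mapsto\mu_{xy}$, is symmetric, zero on the diagonal, and satisfies $\sum_{y\in X}\mu_{xy}<\infty$ for all $x\in X$ (local finiteness is not assumed). Write $x\sim y$ if $\mu_{xy}>0$. The graph is connected if any two vertices $x,y$ are joined by a path $x=x_0\sim x_1\sim\dots\sim x_n=y$. Subharmonic: let $F(X)=\{f:X\to\mathbb{R}\mid \sum_{y\in X}\mu_{xy}|f(y)|<\infty \text{ for all }x\in X\}$ and $\Delta f(x)=\frac1{m(x)}\sum_{y\in X}\mu_{xy}(f(x)-f(y))$ for $f\in F(X)$. A function $f:X\to\mathbb{R}$ is subharmonic if $f\in F(X)$ and $\Delta f\le 0$ pointwise. Compatible intrinsic metric: a pseudo metric is a symmetric map $\rho:X\times X\to[0,\infty)$ with zero diagonal satisfying the triangle inequality. It is intrinsic if $\sum_{y\in X}\mu_{xy}\rho^2(x,y)\le m(x)$ for all $x\in X$. Its jump size is $s=\sup\{\rho(x,y)\mid x\sim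 y\}$. The weighted vertex degree is $\mathrm{Deg}(x)=\frac1{m(x)}\sum_{y\in X}\mu_{xy}$. A pseudo metric is compatible if $s<\infty$ and $\mathrm{Deg}$ is bounded on each ball $B_r$, $r\ge0$. $\|\cdot\|_p$ is the norm of $L^p(X,m)$, and $1_A$ is the characteristic function of $A$. In the integrand, $r/\infty=0$ and $r/0=\infty$. *)

theory Defs
  imports "HOL-Analysis.Analysis"
begin

text \<open>The vertex set \<open>X\<close> of a weighted graph is the universe of a countable type.\<close>

locale weighted_graph =
  fixes m :: "'a::countable \<Rightarrow> real" and \<mu> :: "'a \<Rightarrow> 'a \<Rightarrow> real"
  assumes m_pos: "0 < m x"
    and mu_nonneg: "0 \<le> \<mu> x y"
    and mu_sym: "\<mu> x y = \<mu> y x"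
    and mu_diag: "\<mu> x x = 0"
    and mu_summable: "(\<lambda>y. \<mu> x y) summable_on UNIV"

definition adjacent :: "('a \<Rightarrow> 'a \<Rightarrow> real) \<Rightarrow> 'a \<Rightarrow> 'a \<Rightarrow> bool" where
  "adjacent \<mu> x y \<longleftrightarrow> 0 < \<mu> x y"

definition connected_graph :: "('a \<Rightarrow> 'a \<Rightarrow> real) \<Rightarrow> bool" where
  "connected_graph \<mu> \<longleftrightarrow> (\<forall>x y. (adjacent \<mu>)\<^sup>*\<^sup>* x y)"

definition laplacian_domain :: "('a \<Rightarrow> 'a \<Rightarrow> real) \<Rightarrow> ('a \<Rightarrow> real) set" where
  "laplacian_domain \<mu> = {f. \<forall>x. (\<lambda>y. \<mu> x y * \<bar>f y\<bar>) summable_on UNIV}"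

definition laplacian ::
    "('a \<Rightarrow> real) \<Rightarrow> ('a \<Rightarrow> 'a \<Rightarrow> real) \<Rightarrow> ('a \<Rightarrow> real) \<Rightarrow> 'a \<Rightarrow> real" where
  "laplacian m \<mu> f x = 1 / m x * (\<Sum>\<^sub>\<infinity>y. \<mu> x y * (f x - f y))"

definition subharmonic ::
    "('a \<Rightarrow> real) \<Rightarrow> ('a \<Rightarrow> 'a \<Rightarrow> real) \<Rightarrow> ('a \<Rightarrow> real) \<Rightarrow> bool" where
  "subharmonic m \<mu> f \<longleftrightarrow> f \<in> laplacian_domain \<mu> \<and> (\<forall>x. laplacian m \<mu> f x \<le> 0)"

definition pseudo_metric :: "('a \<Rightarrow> 'a \<Rightarrow> real) \<Rightarrow> bool" where
  "pseudo_metric \<rho> \<longleftrightarrow>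
     (\<forall>x y. 0 \<le> \<rho> x y) \<and> (\<forall>x y. \<rho> x y = \<rho> y x) \<and> (\<forall>x. \<rho> x x = 0) \<and>
     (\<forall>x y z. \<rho> x z \<le> \<rho> x y + \<rho> y z)"

text \<open>Summability is required explicitly, since \<^const>\<open>infsum\<close> of a divergent series is \<open>0\<close>.\<close>

definition intrinsic ::
    "('a \<Rightarrow> real) \<Rightarrow> ('a \<Rightarrow> 'a \<Rightarrow> real) \<Rightarrow> ('a \<Rightarrow> 'a \<Rightarrow> real) \<Rightarrow> bool" where
  "intrinsic m \<mu> \<rho> \<longleftrightarrow>
     (\<forall>x. (\<lambda>y. \<mu> x y * (\<rho> x y)\<^sup>2) summable_on UNIV \<and>
          (\<Sum>\<^sub>\<infinity>y. \<mu> x y * (\<rho> x y)\<^sup>2) \<le> m x)"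

definition jump_size :: "('a \<Rightarrow> 'a \<Rightarrow> real) \<Rightarrow> ('a \<Rightarrow> 'a \<Rightarrow> real) \<Rightarrow> ennreal" where
  "jump_size \<mu> \<rho> = (SUP (x, y) \<in> {(x, y). adjacent \<mu> x y}. ennreal (\<rho> x y))"

definition weighted_degree :: "('a \<Rightarrow> real) \<Rightarrow> ('a \<Rightarrow> 'a \<Rightarrow> real) \<Rightarrow> 'a \<Rightarrow> real" where
  "weighted_degree m \<mu> x = 1 / m x * (\<Sum>\<^sub>\<infinity>y. \<mu> x y)"

definition dist_ball :: "('a \<Rightarrow> 'a \<Rightarrow> real) \<Rightarrow> 'a \<Rightarrow> real \<Rightarrow> 'a set" where
  "dist_ball \<rho> x0 r = {x. \<rho> x x0 \<le> r}"

text \<open>By the triangle inequality, the condition on balls does not depend on the centre \<open>x0\<close>.\<close>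

definition compatible ::
    "('a \<Rightarrow> real) \<Rightarrow> ('a \<Rightarrow> 'a \<Rightarrow> real) \<Rightarrow> 'a \<Rightarrow> ('a \<Rightarrow> 'a \<Rightarrow> real) \<Rightarrow> bool" where
  "compatible m \<mu> x0 \<rho> \<longleftrightarrow>
     jump_size \<mu> \<rho> < \<infinity> \<and>
     (\<forall>r\<ge>0. bounded (weighted_degree m \<mu> ` dist_ball \<rho> x0 r))"

definition vertex_measure :: "('a \<Rightarrow> real) \<Rightarrow> 'a measure" where
  "vertex_measure m = point_measure UNIV (\<lambda>x. ennreal (m x))"

text \<open>Powers of extended non-negative reals, meant for positive exponents only.\<close>

definition ennreal_powr :: "ennreal \<Rightarrow> real \<Rightarrow> ennreal" where
  "ennreal_powr a q = (if a = \<infinity> then \<infinity> else ennreal (enn2real a powr q))"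

definition Lp_norm :: "real \<Rightarrow> 'a measure \<Rightarrow> ('a \<Rightarrow> real) \<Rightarrow> ennreal" where
  "Lp_norm p M g = ennreal_powr (\<integral>\<^sup>+x. ennreal (\<bar>g x\<bar> powr p) \<partial>M) (1 / p)"

lemma Lp_norm_powr:
  assumes "0 < p"
  shows "ennreal_powr (Lp_norm p M g) p = (\<integral>\<^sup>+x. ennreal (\<bar>g x\<bar> powr p) \<partial>M)"
  using assms by (simp add: Lp_norm_def ennreal_powr_def powr_powr less_top)

end

theory Submission
  imports Defs
begin

text \<open>\<^bold>\<open>Why the theorem holds.\<close> Write \<open>v(r)\<close> for the \<open>p\<close>-th power of the \<open>L\<^sup>p\<close> norm of \<open>f\<close> on the ball
  \<open>B\<^sub>r\<close> and \<open>E(r)\<close> for the energy of \<open>f\<close> on pairs of vertices in \<open>B\<^sub>r\<close>, the sum of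
  \<open>\<mu> x y * (f x - f y) * (f x powr (p - 1) - f y powr (p - 1))\<close>. The density of \<open>E\<close> is non-negative and
  vanishes on an edge only if \<open>f\<close> takes the same value at both ends; so on a connected graph it
  suffices to show that \<open>E\<close> vanishes on all large balls.

  Test \<open>\<Delta>f \<le> 0\<close> with \<open>\<phi>\<^sup>2 f\<^bsup>p-1\<^esup>\<close>, where \<open>\<phi>\<close> is a Lipschitz cutoff between \<open>B\<^sub>r\<close> and \<open>B\<^bsub>2r\<^esub>\<close>. The
  metric is intrinsic, so \<open>|\<nabla>\<phi>|\<^sup>2\<close> is at most of order \<open>r\<^bsup>-2\<^esup>\<close>, and with \<open>M\<close> a multiple of
  \<open>v(2 r) / r\<^sup>2\<close> two estimates follow (\<open>caccioppoli\<close>, \<open>annulus\<close>): the Caccioppoli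
  inequality \<open>E(r) \<le> 4 M\<close>, and, because the error terms live only where \<open>\<phi>\<close> varies,
  \<open>E(r) \<le> t (E(2 r) - E(r)) + M / t\<close> for every \<open>t > 0\<close>.

  Together they give, as long as \<open>E(r) > 0\<close>, a bound of \<open>r\<^sup>2 / v(2 r)\<close> by a constant times
  \<open>1 / E(r) - 1 / E(2 r)\<close> (\<open>reciprocal_gap_of_interpolation\<close>, \<open>dyadic_energy_estimate\<close>).
  Along \<open>r = 2\<^sup>j R\<close> the right-hand sides telescope. Hence if \<open>E(R) > 0\<close> for some large \<open>R\<close>, then the
  sum of \<open>4\<^sup>j R\<^sup>2 / v(2\<^bsup>j+1\<^esup> R)\<close> is finite. By monotonicity of \<open>v\<close> it dominates the integral of
  \<open>r / v(r)\<close> at infinity up to a factor (\<open>nn_integral_dyadic_bound\<close>), contrary to the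
  assumption.

  The exponent \<open>p\<close> enters the energy estimates only through elementary inequalities on a single edge. Compatibility of the
  metric enters twice: bounded degrees on balls justify summation by parts although balls may be
  infinite, and the finite jump size keeps the neighbours of the support of \<open>\<phi>\<close> inside \<open>B\<^bsub>2r\<^esub>\<close>.\<close>

section \<open>Elementary inequalities for powers\<close>

text \<open>By homogeneity this is a statement about \<open>t = b / a \<in> [0, 1]\<close>: for \<open>q \<ge> 1\<close> it says
  \<open>t\<^sup>q \<le> t\<close>, and for \<open>q < 1\<close> it says that the concave function \<open>t\<^sup>q\<close> lies below its tangent at \<open>1\<close>.\<close>

lemma powr_diff_lower_bound:
  fixes a b q :: real
  assumes "0 \<le> b" "b \<le> a" "0 < a" "0 < q"
  shows "min 1 q * (a - b) * a powr (q - 1) \<le> a powr q - b powr q"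
proof -
  define t where "t = b / a"
  have t: "0 \<le> t" "t \<le> 1" and b: "b = t * a"
    using assms by (auto simp: t_def)
  have main: "min 1 q * (1 - t) \<le> 1 - t powr q"
  proof (cases "1 \<le> q")
    case True
    then show ?thesis
      using t powr_le_one_le[of t q] by (cases "t = 0") auto
  next
    case False
    have "t powr q * 1 powr (1 - q) \<le> q * t + (1 - q) * 1"
      using False t assms Youngs_inequality_0[of q "1 - q" t 1] by (cases "t = 0") auto
    with False show ?thesis
      by (simp add: algebra_simps min_def)
  qed
  have "min 1 q * (a - b) * a powr (q - 1) = min 1 q * (1 - t) * (a * a powr (q - 1))"
    by (simp add: b algebra_simps)
  also have "a * a powr (q - 1) = a powr q"
    using assms by (simp add: powr_mult_base)
  also have "min 1 q * (1 - t) * a powr q \<le> (1 - t powr q) * a powr q"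
    using main by (intro mult_right_mono) auto
  also have "\<dots> = a powr q - b powr q"
    using t assms by (simp add: b powr_mult algebra_simps)
  finally show ?thesis .
qed

text \<open>The discrete substitute for \<open>f\<^bsup>p-2\<^esup> |\<nabla>f|\<^sup>2\<close>: the chain rule gives
  \<open>\<nabla>f \<cdot> \<nabla>(f\<^bsup>p-1\<^esup>) = (p - 1) f\<^bsup>p-2\<^esup> |\<nabla>f|\<^sup>2\<close>, and the product of the differences of \<open>f\<close> and
  \<open>f\<^bsup>p-1\<^esup>\<close> along an edge, unlike \<open>f\<^bsup>p-2\<^esup> |\<nabla>f|\<^sup>2\<close>, also makes sense where \<open>f\<close> vanishes and \<open>p < 2\<close>.\<close>

definition powr_form :: "real \<Rightarrow> real \<Rightarrow> real \<Rightarrow> real" where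
  "powr_form p a b = (a - b) * (a powr (p - 1) - b powr (p - 1))"

lemma powr_form_commute: "powr_form p a b = powr_form p b a"
  by (simp add: powr_form_def algebra_simps)

lemma powr_form_nonneg:
  assumes "1 < p" "0 \<le> a" "0 \<le> b"
  shows "0 \<le> powr_form p a b"
proof (cases "a \<le> b")
  case True
  then have "a powr (p - 1) \<le> b powr (p - 1)"
    using assms by (intro powr_mono2) auto
  then show ?thesis
    using True by (simp add: powr_form_def mult_nonpos_nonpos)
next
  case False
  then have "b powr (p - 1) \<le> a powr (p - 1)"
    using assms by (intro powr_mono2) auto
  then show ?thesis
    using False by (simp add: powr_form_def)
qed

lemma powr_form_pos:
  assumes "1 < p" "0 \<le> a" "0 \<le> b" "a \<noteq> b"
  shows "0 < powr_form p a b"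
proof -
  have "(a - b) * (a powr (p - 1) - b powr (p - 1)) > 0"
  proof (cases "a < b")
    case True
    then have "a powr (p - 1) < b powr (p - 1)"
      using assms by (intro powr_less_mono2) auto
    then show ?thesis
      using True by (simp add: mult_neg_neg)
  next
    case False
    then have "b powr (p - 1) < a powr (p - 1)"
      using assms by (intro powr_less_mono2) auto
    then show ?thesis
      using False assms by simp
  qed
  then show ?thesis by (simp add: powr_form_def)
qed

lemma mult_powr_pred: "0 \<le> a \<Longrightarrow> a * a powr (p - 1) = a powr (p :: real)"
  by (simp add: powr_mult_base)

lemma diff_powr_pred_le:
  fixes a b p :: real
  assumes "1 < p" "0 \<le> a" "0 \<le> b"
  shows "\<bar>a - b\<bar> * a powr (p - 1) \<le> a powr p + b powr p"
proof (cases "b \<le> a")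
  case True
  then have "\<bar>a - b\<bar> * a powr (p - 1) \<le> a * a powr (p - 1)"
    using assms by (intro mult_right_mono) auto
  then show ?thesis using assms by (simp add: mult_powr_pred add_increasing2)
next
  case False
  then have "\<bar>a - b\<bar> * a powr (p - 1) \<le> b * b powr (p - 1)"
    using assms by (intro mult_mono powr_mono2) auto
  then show ?thesis using assms by (simp add: mult_powr_pred add_increasing)
qed

lemma powr_form_le:
  assumes "1 < p" "0 \<le> a" "0 \<le> b"
  shows "powr_form p a b \<le> a powr p + b powr p"
proof -
  have "powr_form p a b = a * a powr (p - 1) + b * b powr (p - 1)
        - (a * b powr (p - 1) + b * a powr (p - 1))"
    by (simp add: powr_form_def algebra_simps)
  also have "\<dots> \<le> a powr p + b powr p"
  proof -
    have "0 \<le> a * b powr (p - 1) + b * a powr (p - 1)"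
      using assms by (intro add_nonneg_nonneg mult_nonneg_nonneg) auto
    then show ?thesis
      using assms mult_powr_pred[of a p] mult_powr_pred[of b p] by linarith
  qed
  finally show ?thesis .
qed

text \<open>This replaces the chain rule: a first-order difference of \<open>f\<close> times \<open>f\<^bsup>p-1\<^esup>\<close> is controlled by the
  geometric mean of the energy density and \<open>f\<^sup>p\<close>. For \<open>a \<le> b\<close> both powers on the left are at most
  \<open>b\<^bsup>p-1\<^esup>\<close>, and one of the two factors \<open>b - a\<close> turns into a difference of powers by
  \<open>powr_diff_lower_bound\<close>.\<close>

lemma powr_form_lower_bound:
  assumes "1 < p" "0 \<le> a" "0 \<le> b"
  shows "min 1 (p - 1) * ((a - b) * (a powr (p - 1) + b powr (p - 1)))\<^sup>2
         \<le> 4 * powr_form p a b * (a powr p + b powr p)"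
  using assms
proof (induction a b rule: linorder_wlog)
  case (le a b)
  show ?case
  proof (cases "b = 0")
    case True
    then show ?thesis using le by (simp add: powr_form_def)
  next
    case False
    then have b: "0 < b" using le by simp
    define q where "q = p - 1"
    define c where "c = min 1 q"
    have q: "0 < q" "p = q + 1" and c: "0 < c" using le by (auto simp: q_def c_def)
    have aq: "a powr q \<le> b powr q" using le q by (intro powr_mono2) auto
    have "c * ((a - b) * (a powr q + b powr q))\<^sup>2
        = c * (b - a)\<^sup>2 * (a powr q + b powr q)\<^sup>2"
      by (simp add: power_mult_distrib power2_commute)
    also have "\<dots> \<le> c * (b - a)\<^sup>2 * (2 * b powr q)\<^sup>2"
      using aq c by (intro mult_left_mono power_mono) auto
    also have "\<dots> = 4 * (b - a) * (c * (b - a) * b powr (q - 1)) * b powr p"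
    proof -
      have "b powr q = b powr (q - 1) * b"
        using b mult_powr_pred[of b q] by (simp add: mult.commute)
      moreover have "b powr p = b powr q * b"
        using b mult_powr_pred[of b p] by (simp add: mult.commute q_def)
      ultimately show ?thesis
        by (simp add: power2_eq_square)
    qed
    also have "\<dots> \<le> 4 * (b - a) * (b powr q - a powr q) * b powr p"
      using powr_diff_lower_bound[of a b q] le b q
      by (intro mult_right_mono mult_left_mono) (auto simp: c_def)
    also have "\<dots> \<le> 4 * (b - a) * (b powr q - a powr q) * (a powr p + b powr p)"
      using le aq by (intro mult_left_mono) auto
    finally show ?thesis
      by (simp add: powr_form_def c_def q_def algebra_simps)
  qed
next
  case (sym a b)
  then show ?case
    by (simp add: powr_form_commute[of p b a] add.commute power_mult_distrib power2_commute)
qed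

text \<open>Young's inequality with a free weight \<open>t\<close>. Keeping \<open>t\<close> free until after summation replaces the
  Cauchy--Schwarz inequality for the sums over edges.\<close>

lemma mult_le_weighted_squares:
  fixes u v w t :: real
  assumes "u\<^sup>2 \<le> 4 * v * w" "0 \<le> v" "0 \<le> w" "0 < t"
  shows "\<bar>u\<bar> \<le> t * v + w / t"
proof -
  have "u\<^sup>2 \<le> (t * v + w / t)\<^sup>2"
  proof -
    have "(t * v + w / t)\<^sup>2 = (t * v - w / t)\<^sup>2 + 4 * v * w"
      using assms by (simp add: power2_sum power2_diff)
    then show ?thesis
      using assms(1) zero_le_power2[of "t * v - w / t"] by linarith
  qed
  then show ?thesis
    using assms by (simp add: abs_le_square_iff[symmetric])
qed

text \<open>The right-hand side is the weak form of \<open>\<Delta>f\<close> tested with \<open>\<phi>\<^sup>2 f\<^bsup>p-1\<^esup>\<close>, on one edge. The discrete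
  product rule splits it into the energy density with the mean of \<open>\<phi>\<^sup>2\<close> as weight and a term with
  the difference of \<open>\<phi>\<^sup>2\<close>. That term vanishes unless the edge lies where the cutoff varies, and
  there Young's inequality splits it once more. The factor \<open>of_bool (\<phi> \<noteq> \<psi>)\<close> keeps this
  localisation, on which the final summation over dyadic annuli rests.\<close>

lemma cutoff_powr_form_inequality:
  fixes p a b \<phi> \<psi> t :: real
  assumes p: "1 < p" and ab: "0 \<le> a" "0 \<le> b" and t: "0 < t"
  shows "(\<phi>\<^sup>2 + \<psi>\<^sup>2) * powr_form p a b * (1 - t * of_bool (\<phi> \<noteq> \<psi>))
       - 2 / (min 1 (p - 1) * t) * (\<phi> - \<psi>)\<^sup>2 * (a powr p + b powr p)
     \<le> 2 * ((a - b) * (\<phi>\<^sup>2 * a powr (p - 1) - \<psi>\<^sup>2 * b powr (p - 1)))"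
proof -
  define A where "A = a powr (p - 1)"
  define B where "B = b powr (p - 1)"
  define e where "e = powr_form p a b"
  define P where "P = a powr p + b powr p"
  define c where "c = min 1 (p - 1)"
  have c: "0 < c" using p by (simp add: c_def)
  have e: "0 \<le> e" "e = (a - b) * (A - B)"
    using powr_form_nonneg[OF p ab] by (simp_all add: e_def powr_form_def A_def B_def)
  have P: "0 \<le> P"
    by (simp add: P_def)
  have split: "2 * ((a - b) * (\<phi>\<^sup>2 * A - \<psi>\<^sup>2 * B))
      = (\<phi>\<^sup>2 + \<psi>\<^sup>2) * e + (\<phi> - \<psi>) * (\<phi> + \<psi>) * ((a - b) * (A + B))"
    by (simp add: e power2_eq_square algebra_simps)
  show ?thesis
  proof (cases "\<phi> = \<psi>")
    case True
    then show ?thesis using split by (simp add: A_def B_def e_def)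
  next
    case False
    define u where "u = (\<phi> - \<psi>) * (\<phi> + \<psi>) * ((a - b) * (A + B))"
    have s: "(\<phi> + \<psi>)\<^sup>2 \<le> 2 * (\<phi>\<^sup>2 + \<psi>\<^sup>2)"
      using sum_squares_bound[of \<phi> \<psi>] by (simp add: power2_sum)
    have "((a - b) * (A + B))\<^sup>2 \<le> 4 * e * P / c"
      using powr_form_lower_bound[OF p ab] c
      by (simp add: A_def B_def e_def P_def c_def field_simps)
    then have "u\<^sup>2 \<le> (\<phi> - \<psi>)\<^sup>2 * (2 * (\<phi>\<^sup>2 + \<psi>\<^sup>2)) * (4 * e * P / c)"
      unfolding u_def power_mult_distrib[of "(\<phi> - \<psi>) * (\<phi> + \<psi>)"]
        power_mult_distrib[of "\<phi> - \<psi>"]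
      using s e(1) P c by (intro mult_mono) auto
    also have "\<dots> = 4 * ((\<phi>\<^sup>2 + \<psi>\<^sup>2) * e) * (2 / c * (\<phi> - \<psi>)\<^sup>2 * P)"
      by (simp add: field_simps)
    finally have "\<bar>u\<bar> \<le> t * ((\<phi>\<^sup>2 + \<psi>\<^sup>2) * e) + 2 / c * (\<phi> - \<psi>)\<^sup>2 * P / t"
      using e(1) P c t by (intro mult_le_weighted_squares) auto
    then have "- u \<le> t * ((\<phi>\<^sup>2 + \<psi>\<^sup>2) * e) + 2 / (c * t) * (\<phi> - \<psi>)\<^sup>2 * P"
      by (simp add: field_simps)
    then show ?thesis
      using split False unfolding A_def[symmetric] B_def[symmetric] e_def[symmetric]
        P_def[symmetric] c_def[symmetric] u_def by (simp add: algebra_simps)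
  qed
qed

section \<open>Summation by parts on a weighted graph\<close>

lemma infsum_prod_swap:
  "(\<Sum>\<^sub>\<infinity>(x, y)\<in>A \<times> B. f y x) = (\<Sum>\<^sub>\<infinity>(x, y)\<in>B \<times> A. f x y)"
  by (rule infsum_reindex_bij_witness[of _ prod.swap prod.swap]) auto

lemma summable_on_prod_swap:
  assumes "(\<lambda>(x, y). f x y) summable_on A \<times> B"
  shows "(\<lambda>(x, y). f y x) summable_on B \<times> A"
  using assms by (subst (asm) summable_on_swap) simp

definition power_mass :: "('a \<Rightarrow> real) \<Rightarrow> real \<Rightarrow> ('a \<Rightarrow> real) \<Rightarrow> 'a set \<Rightarrow> real" where
  "power_mass m p f A = (\<Sum>\<^sub>\<infinity>x\<in>A. m x * f x powr p)"

definition powr_energy ::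
    "('a \<Rightarrow> 'a \<Rightarrow> real) \<Rightarrow> real \<Rightarrow> ('a \<Rightarrow> real) \<Rightarrow> 'a set \<Rightarrow> real" where
  "powr_energy \<mu> p f A = (\<Sum>\<^sub>\<infinity>(x, y)\<in>A \<times> A. \<mu> x y * powr_form p (f x) (f y))"

context weighted_graph
begin

lemma infsum_mu: "(\<Sum>\<^sub>\<infinity>y. \<mu> x y) = m x * weighted_degree m \<mu> x"
  using m_pos[of x] by (simp add: weighted_degree_def)

text \<open>Here the bound on the weighted degree enters: it makes the edge measure \<open>\<mu>\<close> comparable with the
  vertex measure \<open>m\<close> on balls, so that infinite balls and vertices of infinite combinatorial degree
  do no harm.\<close>

lemma summable_on_mu_mult_rows:
  assumes deg: "\<And>x. x \<in> A \<Longrightarrow> weighted_degree m \<mu> x \<le> D"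
    and h: "\<And>x. 0 \<le> h x" and mass: "(\<lambda>x. m x * h x) summable_on A"
  shows "(\<lambda>(x, y). \<mu> x y * h x) summable_on A \<times> A"
proof -
  have "(\<lambda>(x, y). \<mu> x y * h x) summable_on A \<times> UNIV"
  proof (rule summable_on_SigmaI)
    show "((\<lambda>y. case (x, y) of (x, y) \<Rightarrow> \<mu> x y * h x) has_sum (\<Sum>\<^sub>\<infinity>y. \<mu> x y) * h x) UNIV" for x
      using has_sum_cmult_left[OF has_sum_infsum[OF mu_summable[of x]], of "h x"] by simp
    show "(\<lambda>x. (\<Sum>\<^sub>\<infinity>y. \<mu> x y) * h x) summable_on A"
    proof (rule summable_on_comparison_test)
      show "(\<lambda>x. D * (m x * h x)) summable_on A"
        by (intro summable_on_cmult_right mass)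
      show "(\<Sum>\<^sub>\<infinity>y. \<mu> x y) * h x \<le> D * (m x * h x)" if "x \<in> A" for x
        using mult_right_mono[OF deg[OF that], of "m x * h x"] m_pos[of x] h[of x]
        by (simp add: infsum_mu ac_simps)
      show "0 \<le> (\<Sum>\<^sub>\<infinity>y. \<mu> x y) * h x" for x
        by (intro mult_nonneg_nonneg infsum_nonneg mu_nonneg h)
    qed
  qed (auto simp: mu_nonneg h)
  then show ?thesis
    by (rule summable_on_subset_banach) auto
qed

lemma summable_on_mu_mult_pairs:
  assumes "\<And>x. x \<in> A \<Longrightarrow> weighted_degree m \<mu> x \<le> D"
    and "\<And>x. 0 \<le> h x" and "(\<lambda>x. m x * h x) summable_on A"
  shows "(\<lambda>(x, y). \<mu> x y * (h x + h y)) summable_on A \<times> A"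
proof -
  note s = summable_on_mu_mult_rows[of A D h, OF assms]
  have "(\<lambda>z. (case z of (x, y) \<Rightarrow> \<mu> x y * h x) + (case z of (x, y) \<Rightarrow> \<mu> y x * h y))
      summable_on A \<times> A"
    by (intro summable_on_add s summable_on_prod_swap[OF s])
  then show ?thesis
    by (simp add: case_prod_unfold distrib_left mu_sym[of "snd _" "fst _"])
qed

lemma powr_energy_summable:
  assumes "1 < p" "\<And>x. 0 \<le> f x" "\<And>x. x \<in> A \<Longrightarrow> weighted_degree m \<mu> x \<le> D"
    and "(\<lambda>x. m x * f x powr p) summable_on A"
  shows "(\<lambda>(x, y). \<mu> x y * powr_form p (f x) (f y)) summable_on A \<times> A"
proof (rule summable_on_comparison_test[OF summable_on_mu_mult_pairs[of A D "\<lambda>x. f x powr p"]])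
  show "(case z of (x, y) \<Rightarrow> \<mu> x y * powr_form p (f x) (f y))
      \<le> (case z of (x, y) \<Rightarrow> \<mu> x y * (f x powr p + f y powr p))" for z
    using assms powr_form_le[of p] by (auto split: prod.split intro!: mult_left_mono mu_nonneg)
  show "0 \<le> (case z of (x, y) \<Rightarrow> \<mu> x y * powr_form p (f x) (f y))" for z
    using assms powr_form_nonneg[of p] by (auto split: prod.split intro!: mult_nonneg_nonneg mu_nonneg)
qed (use assms in auto)

text \<open>An intrinsic metric is one for which functions that are \<open>L\<close>-Lipschitz have
  \<open>|\<nabla>\<phi>|\<^sup>2 \<le> L\<^sup>2\<close>, where \<open>|\<nabla>\<phi>|\<^sup>2(x)\<close> denotes
  \<open>1 / m x * (\<Sum>\<^sub>\<infinity>y. \<mu> x y * (\<phi> x - \<phi> y)\<^sup>2)\<close>.\<close>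

lemma infsum_intrinsic_le_power_mass:
  assumes \<rho>: "intrinsic m \<mu> \<rho>"
    and h: "\<And>x. 0 \<le> h x" and mass: "(\<lambda>x. m x * h x) summable_on A"
    and lip: "\<And>x y. \<bar>\<phi> x - \<phi> y\<bar> \<le> L * \<rho> x y"
  shows "(\<lambda>(x, y). \<mu> x y * (\<phi> x - \<phi> y)\<^sup>2 * h x) summable_on A \<times> A"
    and "(\<Sum>\<^sub>\<infinity>(x, y)\<in>A \<times> A. \<mu> x y * (\<phi> x - \<phi> y)\<^sup>2 * h x) \<le> L\<^sup>2 * (\<Sum>\<^sub>\<infinity>x\<in>A. m x * h x)"
proof -
  have le: "(\<phi> x - \<phi> y)\<^sup>2 \<le> L\<^sup>2 * (\<rho> x y)\<^sup>2" for x y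
    using power_mono[OF lip[of x y], of 2] by (simp add: power_mult_distrib)
  have \<rho>_sum: "(\<lambda>y. \<mu> x y * (\<rho> x y)\<^sup>2) summable_on UNIV"
    and \<rho>_le: "(\<Sum>\<^sub>\<infinity>y. \<mu> x y * (\<rho> x y)\<^sup>2) \<le> m x" for x
    using \<rho> by (auto simp: intrinsic_def)
  define I where "I x = (\<Sum>\<^sub>\<infinity>y. \<mu> x y * (\<rho> x y)\<^sup>2)" for x
  have I_nonneg: "0 \<le> I x" for x
    unfolding I_def by (intro infsum_nonneg mult_nonneg_nonneg mu_nonneg) auto
  have dom_row: "((\<lambda>y. L\<^sup>2 * (\<mu> x y * (\<rho> x y)\<^sup>2) * h x) has_sum L\<^sup>2 * I x * h x) UNIV" for x
    unfolding I_def
    by (intro has_sum_cmult_left has_sum_cmult_right has_sum_infsum \<rho>_sum)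
  have term_le: "\<mu> x y * (\<phi> x - \<phi> y)\<^sup>2 * h x \<le> L\<^sup>2 * (\<mu> x y * (\<rho> x y)\<^sup>2) * h x" for x y
  proof -
    have "\<mu> x y * (\<phi> x - \<phi> y)\<^sup>2 * h x \<le> \<mu> x y * (L\<^sup>2 * (\<rho> x y)\<^sup>2) * h x"
      by (intro mult_right_mono mult_left_mono le mu_nonneg h)
    then show ?thesis by (simp add: mult.left_commute)
  qed
  have term_nonneg: "0 \<le> \<mu> x y * (\<phi> x - \<phi> y)\<^sup>2 * h x" for x y
    by (intro mult_nonneg_nonneg mu_nonneg h) auto
  have row_le: "L\<^sup>2 * I x * h x \<le> L\<^sup>2 * (m x * h x)" for x
    using \<rho>_le[of x] h[of x] by (simp add: I_def mult.assoc mult_left_mono mult_right_mono)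
  have mass': "(\<lambda>x. L\<^sup>2 * (m x * h x)) summable_on A"
    by (intro summable_on_cmult_right mass)
  have dom_sum: "(\<lambda>x. L\<^sup>2 * I x * h x) summable_on A"
    by (rule summable_on_comparison_test[OF mass' row_le]) (auto intro!: mult_nonneg_nonneg I_nonneg h)
  have dom: "(\<lambda>(x, y). L\<^sup>2 * (\<mu> x y * (\<rho> x y)\<^sup>2) * h x) summable_on A \<times> UNIV"
    by (rule summable_on_SigmaI[OF _ dom_sum])
      (use dom_row in \<open>auto intro!: mult_nonneg_nonneg mu_nonneg h\<close>)
  then have dom': "(\<lambda>(x, y). L\<^sup>2 * (\<mu> x y * (\<rho> x y)\<^sup>2) * h x) summable_on A \<times> A"
    by (rule summable_on_subset_banach) auto
  then show sum: "(\<lambda>(x, y). \<mu> x y * (\<phi> x - \<phi> y)\<^sup>2 * h x) summable_on A \<times> A"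
    by (rule summable_on_comparison_test) (auto intro: term_le term_nonneg)
  have "(\<Sum>\<^sub>\<infinity>(x, y)\<in>A \<times> A. \<mu> x y * (\<phi> x - \<phi> y)\<^sup>2 * h x)
      \<le> (\<Sum>\<^sub>\<infinity>(x, y)\<in>A \<times> A. L\<^sup>2 * (\<mu> x y * (\<rho> x y)\<^sup>2) * h x)"
    by (rule infsum_mono[OF sum dom']) (auto intro: term_le)
  also have "\<dots> \<le> (\<Sum>\<^sub>\<infinity>(x, y)\<in>A \<times> UNIV. L\<^sup>2 * (\<mu> x y * (\<rho> x y)\<^sup>2) * h x)"
    by (rule infsum_mono2[OF dom' dom]) (auto intro!: mult_nonneg_nonneg mu_nonneg h)
  also have "\<dots> = (\<Sum>\<^sub>\<infinity>x\<in>A. L\<^sup>2 * I x * h x)"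
    by (simp add: infsumI[OF dom_row] flip: infsum_Sigma'_banach[OF dom])
  also have "\<dots> \<le> (\<Sum>\<^sub>\<infinity>x\<in>A. L\<^sup>2 * (m x * h x))"
    by (intro infsum_mono dom_sum mass' row_le)
  also have "\<dots> = L\<^sup>2 * (\<Sum>\<^sub>\<infinity>x\<in>A. m x * h x)"
    by (simp add: infsum_cmult_right')
  finally show "(\<Sum>\<^sub>\<infinity>(x, y)\<in>A \<times> A. \<mu> x y * (\<phi> x - \<phi> y)\<^sup>2 * h x)
      \<le> L\<^sup>2 * (\<Sum>\<^sub>\<infinity>x\<in>A. m x * h x)" .
qed

text \<open>Green's formula for the test function \<open>\<phi>\<^sup>2 f\<^bsup>p-1\<^esup>\<close>. Absolute summability, which permits the
  exchange of \<open>x\<close> and \<open>y\<close>, comes from \<open>f \<in> L\<^sup>p\<close> and the degree bound. Both are required on a set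
  \<open>S\<close> that contains the support of \<open>\<phi>\<close> together with all its neighbours, since the value of \<open>f\<close> at
  a neighbour of the support enters \<open>\<Delta>f\<close>.\<close>

lemma weak_subharmonicity:
  assumes f: "\<And>x. 0 \<le> f x" and sub: "subharmonic m \<mu> f" and p: "1 < p"
    and deg: "\<And>x. x \<in> S \<Longrightarrow> weighted_degree m \<mu> x \<le> D"
    and mass: "(\<lambda>x. m x * f x powr p) summable_on S"
    and \<phi>: "\<And>x. 0 \<le> \<phi> x" "\<And>x. \<phi> x \<le> 1"
    and supp: "\<And>x y. \<phi> x \<noteq> 0 \<Longrightarrow> x \<in> S \<and> (adjacent \<mu> x y \<longrightarrow> y \<in> S)"
  shows "(\<lambda>(x, y). \<mu> x y * ((f x - f y) * ((\<phi> x)\<^sup>2 * f x powr (p - 1) - (\<phi> y)\<^sup>2 * f y powr (p - 1))))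
      summable_on S \<times> S" (is "?s summable_on _")
    and "(\<Sum>\<^sub>\<infinity>(x, y)\<in>S \<times> S. \<mu> x y *
        ((f x - f y) * ((\<phi> x)\<^sup>2 * f x powr (p - 1) - (\<phi> y)\<^sup>2 * f y powr (p - 1)))) \<le> 0"
proof -
  define k where "k x y = \<mu> x y * (f x - f y) * ((\<phi> x)\<^sup>2 * f x powr (p - 1))" for x y
  have "(\<lambda>z. norm (case z of (x, y) \<Rightarrow> k x y)) summable_on S \<times> S"
  proof (rule Infinite_Sum.abs_summable_on_comparison_test')
    show "(\<lambda>(x, y). \<mu> x y * (f x powr p + f y powr p)) summable_on S \<times> S"
      by (rule summable_on_mu_mult_pairs[of S D "\<lambda>x. f x powr p"]) (use deg mass in auto)
    fix z assume "z \<in> S \<times> S"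
    obtain x y where z: "z = (x, y)" by fastforce
    have "(\<phi> x)\<^sup>2 \<le> 1"
      using \<phi>[of x] by (simp add: power_le_one)
    then have "\<mu> x y * ((\<phi> x)\<^sup>2 * (\<bar>f x - f y\<bar> * f x powr (p - 1)))
        \<le> \<mu> x y * (1 * (f x powr p + f y powr p))"
      by (intro mult_left_mono mult_mono diff_powr_pred_le p f mu_nonneg) auto
    then show "norm (case z of (x, y) \<Rightarrow> k x y)
        \<le> (case z of (x, y) \<Rightarrow> \<mu> x y * (f x powr p + f y powr p))"
      by (simp add: z k_def abs_mult mu_nonneg ac_simps)
  qed
  then have k: "(\<lambda>(x, y). k x y) summable_on S \<times> S"
    by (rule abs_summable_summable)
  have k_swap: "(\<lambda>(x, y). k y x) summable_on S \<times> S"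
    by (rule summable_on_prod_swap[OF k])
  have row: "(\<Sum>\<^sub>\<infinity>y\<in>S. k x y) \<le> 0" if "x \<in> S" for x
  proof -
    have "(\<Sum>\<^sub>\<infinity>y\<in>S. k x y) = (\<Sum>\<^sub>\<infinity>y. k x y)"
    proof (rule infsum_cong_neutral)
      fix y assume "y \<in> UNIV - S"
      then have "\<phi> x = 0 \<or> \<mu> x y = 0"
        using supp[of x y] mu_nonneg[of x y] by (auto simp: adjacent_def)
      then show "k x y = 0" by (auto simp: k_def)
    qed auto
    also have "\<dots> = (\<Sum>\<^sub>\<infinity>y. \<mu> x y * (f x - f y)) * ((\<phi> x)\<^sup>2 * f x powr (p - 1))"
      unfolding k_def by (rule infsum_cmult_left')
    also have "(\<Sum>\<^sub>\<infinity>y. \<mu> x y * (f x - f y)) = m x * laplacian m \<mu> f x"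
      using m_pos[of x] by (simp add: laplacian_def)
    also have "m x * laplacian m \<mu> f x * ((\<phi> x)\<^sup>2 * f x powr (p - 1)) \<le> 0"
      using sub m_pos[of x] by (intro mult_nonpos_nonneg mult_nonneg_nonpos)
        (auto simp: subharmonic_def less_imp_le)
    finally show ?thesis .
  qed
  have k_le: "(\<Sum>\<^sub>\<infinity>(x, y)\<in>S \<times> S. k x y) \<le> 0"
    unfolding infsum_Sigma'_banach[OF k, symmetric]
    using infsum_mono[OF summable_on_Sigma_banach[OF k] summable_on_0_simp row] by simp
  have eq: "?s = (\<lambda>z. (case z of (x, y) \<Rightarrow> k x y) + (case z of (x, y) \<Rightarrow> k y x))"
    by (auto simp: k_def algebra_simps mu_sym)
  show "?s summable_on S \<times> S"
    unfolding eq by (intro summable_on_add k k_swap)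
  show "infsum ?s (S \<times> S) \<le> 0"
    unfolding eq infsum_add[OF k k_swap] using k_le infsum_prod_swap[of k S S] by simp
qed

end

section \<open>Energy estimates for subharmonic functions\<close>

text \<open>Optimising over \<open>t\<close> yields \<open>a\<^sup>2 \<le> 4 M (b - a)\<close>, which bounds the difference of the reciprocals
  only while \<open>a\<close> and \<open>b\<close> are comparable. If \<open>b\<close> is much larger than \<open>a\<close>, then that difference is of
  order \<open>1 / a\<close>, and the bound \<open>a \<le> 4 M\<close> suffices.\<close>

lemma reciprocal_gap_of_interpolation:
  fixes a b M :: real
  assumes a: "0 < a" "a \<le> b" and M: "a \<le> 4 * M"
    and tradeoff: "\<And>t. 0 < t \<Longrightarrow> a \<le> t * (b - a) + M / t"
  shows "1 \<le> 8 * M * (1 / a - 1 / b)"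
proof (cases "2 * a \<le> b")
  case True
  then have "1 / b \<le> 1 / (2 * a)"
    using a by (intro divide_left_mono) auto
  then have "1 / (2 * a) \<le> 1 / a - 1 / b"
    by (simp add: field_simps)
  then have "8 * M * (1 / (2 * a)) \<le> 8 * M * (1 / a - 1 / b)"
    using a M by (intro mult_left_mono) auto
  moreover have "1 \<le> 8 * M * (1 / (2 * a))"
    using a M by simp
  ultimately show ?thesis by linarith
next
  case False
  \<comment> \<open>If \<open>a = b\<close>, letting \<open>t\<close> grow gives \<open>a \<le> 0\<close>; \<open>t = 2 M / a\<close> is large enough.\<close>
  have "a \<noteq> b"
    using tradeoff[of "2 * M / a"] a M by auto
  then have d: "0 < b - a" using a by simp
  \<comment> \<open>This \<open>t\<close> makes the first term of the trade-off absorb half of the left-hand side.\<close>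
  have "a / (2 * (b - a)) * (b - a) = a / 2"
    using d by (simp add: field_simps)
  then have "a \<le> a / 2 + M / (a / (2 * (b - a)))"
    using tradeoff[of "a / (2 * (b - a))"] a d by (simp only:) simp
  then have "2 * a\<^sup>2 \<le> 8 * M * (b - a)"
    using a d by (simp add: field_simps power2_eq_square)
  moreover have "a * b \<le> 2 * a\<^sup>2"
    using False a by (simp add: power2_eq_square)
  ultimately have "a * b \<le> 8 * M * (b - a)" by linarith
  then show ?thesis
    using a by (simp add: field_simps)
qed

locale subharmonic_on_graph = weighted_graph m \<mu>
  for m :: "'a::countable \<Rightarrow> real" and \<mu> +
  fixes \<rho> :: "'a \<Rightarrow> 'a \<Rightarrow> real" and f :: "'a \<Rightarrow> real" and p :: real
  assumes metric: "pseudo_metric \<rho>" and intrinsic: "intrinsic m \<mu> \<rho>"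
    and f_nonneg: "0 \<le> f x" and f_subharmonic: "subharmonic m \<mu> f" and p: "1 < p"
begin

abbreviation "energy \<equiv> powr_energy \<mu> p f"
abbreviation "mass \<equiv> power_mass m p f"
abbreviation "energy_density x y \<equiv> \<mu> x y * powr_form p (f x) (f y)"

lemma energy_density_nonneg: "0 \<le> energy_density x y"
  by (intro mult_nonneg_nonneg mu_nonneg powr_form_nonneg p f_nonneg)

text \<open>The pointwise cutoff inequality summed over all edges in \<open>S\<close>. The weak form of
  \<open>\<Delta>f\<close> on its right-hand side sums to at most zero by subharmonicity, and the gradient term to at
  most a multiple of \<open>L\<^sup>2 mass S\<close>, because the metric is intrinsic. The minorant
  \<open>H\<close> allows different choices of \<open>t\<close> to be exploited without summing the cutoff weights themselves.\<close>

lemma cutoff_estimate: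
  assumes deg: "\<And>x. x \<in> S \<Longrightarrow> weighted_degree m \<mu> x \<le> D"
    and mass: "(\<lambda>x. m x * f x powr p) summable_on S"
    and \<phi>: "\<And>x. 0 \<le> \<phi> x" "\<And>x. \<phi> x \<le> 1"
    and supp: "\<And>x y. \<phi> x \<noteq> 0 \<Longrightarrow> x \<in> S \<and> (adjacent \<mu> x y \<longrightarrow> y \<in> S)"
    and lip: "\<And>x y. \<bar>\<phi> x - \<phi> y\<bar> \<le> L * \<rho> x y"
    and t: "0 < t"
    and H: "(\<lambda>(x, y). H x y) summable_on S \<times> S"
    and H_le: "\<And>x y. x \<in> S \<Longrightarrow> y \<in> S \<Longrightarrow>
      H x y \<le> energy_density x y * (((\<phi> x)\<^sup>2 + (\<phi> y)\<^sup>2) * (1 - t * of_bool (\<phi> x \<noteq> \<phi> y)))"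
  shows "(\<Sum>\<^sub>\<infinity>(x, y)\<in>S \<times> S. H x y) \<le> 4 / (min 1 (p - 1) * t) * (L\<^sup>2 * mass S)"
proof -
  define K where "K = 2 / (min 1 (p - 1) * t)"
  have K: "0 \<le> K" using p t by (simp add: K_def)
  define h where "h x = f x powr p" for x
  define F where "F x y = \<mu> x y * (\<phi> x - \<phi> y)\<^sup>2 * h x" for x y
  define s where "s x y = \<mu> x y *
      ((f x - f y) * ((\<phi> x)\<^sup>2 * f x powr (p - 1) - (\<phi> y)\<^sup>2 * f y powr (p - 1)))" for x y
  have F: "(\<lambda>(x, y). F x y) summable_on S \<times> S"
    and F_le: "(\<Sum>\<^sub>\<infinity>(x, y)\<in>S \<times> S. F x y) \<le> L\<^sup>2 * mass S"
    unfolding F_def power_mass_def h_def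
    by (rule infsum_intrinsic_le_power_mass[OF intrinsic _ mass lip]; simp)+
  note F_swap = summable_on_prod_swap[OF F]
  have s: "(\<lambda>(x, y). s x y) summable_on S \<times> S"
    and s_le: "(\<Sum>\<^sub>\<infinity>(x, y)\<in>S \<times> S. s x y) \<le> 0"
    unfolding s_def
    by (rule weak_subharmonicity[OF f_nonneg f_subharmonic p deg mass \<phi> supp]; assumption)+
  have pointwise: "H x y \<le> 2 * s x y + K * (F x y + F y x)" if "x \<in> S" "y \<in> S" for x y
  proof -
    have "H x y \<le> \<mu> x y * (((\<phi> x)\<^sup>2 + (\<phi> y)\<^sup>2) * powr_form p (f x) (f y)
        * (1 - t * of_bool (\<phi> x \<noteq> \<phi> y)))"
      using H_le[OF that] by (simp add: ac_simps)
    also have "\<dots> \<le> \<mu> x y * (2 * ((f x - f y) *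
          ((\<phi> x)\<^sup>2 * f x powr (p - 1) - (\<phi> y)\<^sup>2 * f y powr (p - 1)))
        + K * (\<phi> x - \<phi> y)\<^sup>2 * (h x + h y))"
      using cutoff_powr_form_inequality[OF p f_nonneg f_nonneg t, of "\<phi> x" "\<phi> y" x y]
      by (intro mult_left_mono mu_nonneg) (simp add: K_def h_def)
    also have "\<dots> = 2 * s x y + K * (F x y + F y x)"
      by (simp add: s_def F_def mu_sym[of y x] power2_commute[of "\<phi> y"] algebra_simps)
    finally show ?thesis .
  qed
  have FF: "(\<lambda>z. (case z of (x, y) \<Rightarrow> F x y) + (case z of (x, y) \<Rightarrow> F y x)) summable_on S \<times> S"
    by (intro summable_on_add F F_swap)
  have "(\<Sum>\<^sub>\<infinity>(x, y)\<in>S \<times> S. H x y)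
      \<le> (\<Sum>\<^sub>\<infinity>z\<in>S \<times> S. 2 * (case z of (x, y) \<Rightarrow> s x y)
          + K * ((case z of (x, y) \<Rightarrow> F x y) + (case z of (x, y) \<Rightarrow> F y x)))"
    using pointwise
    by (intro infsum_mono[OF H] summable_on_add summable_on_cmult_right s FF) auto
  also have "\<dots> = 2 * (\<Sum>\<^sub>\<infinity>(x, y)\<in>S \<times> S. s x y)
      + K * ((\<Sum>\<^sub>\<infinity>(x, y)\<in>S \<times> S. F x y) + (\<Sum>\<^sub>\<infinity>(x, y)\<in>S \<times> S. F y x))"
    by (simp add: infsum_add[OF F F_swap] infsum_add[OF summable_on_cmult_right[OF s]
          summable_on_cmult_right[OF FF]] infsum_cmult_right')
  also have "\<dots> \<le> 2 * 0 + K * (L\<^sup>2 * mass S + L\<^sup>2 * mass S)"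
    using F_le s_le K by (intro add_mono mult_left_mono) (auto simp: infsum_prod_swap[of F S S])
  finally show ?thesis
    by (simp add: K_def)
qed

lemma energy_summable:
  assumes "\<And>x. x \<in> S \<Longrightarrow> weighted_degree m \<mu> x \<le> D"
    and "(\<lambda>x. m x * f x powr p) summable_on S"
  shows "(\<lambda>(x, y). energy_density x y) summable_on S \<times> S"
  by (rule powr_energy_summable[OF p f_nonneg assms]) auto

lemma energy_mono:
  assumes "(\<lambda>(x, y). energy_density x y) summable_on S \<times> S" "B \<subseteq> S"
  shows "energy B \<le> energy S"
  unfolding powr_energy_def
proof (rule infsum_mono2)
  show "(\<lambda>(x, y). energy_density x y) summable_on B \<times> B"
    by (rule summable_on_subset_banach[OF assms(1)]) (use assms(2) in auto)
qed (use assms energy_density_nonneg in auto)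

text \<open>Two readings of the cutoff estimate. With \<open>t = 1 / 2\<close> the weight is positive everywhere, and the
  Caccioppoli inequality results. With general \<open>t\<close> the cutoff error is charged to the energy of the
  edges along which \<open>\<phi>\<close> varies; no such edge has both ends in \<open>B\<close>, so only the energy gained
  between \<open>B\<close> and \<open>S\<close> appears.\<close>

lemma cutoff_energy_bounds:
  assumes deg: "\<And>x. x \<in> S \<Longrightarrow> weighted_degree m \<mu> x \<le> D"
    and mass: "(\<lambda>x. m x * f x powr p) summable_on S"
    and \<phi>: "\<And>x. 0 \<le> \<phi> x" "\<And>x. \<phi> x \<le> 1"
    and supp: "\<And>x y. \<phi> x \<noteq> 0 \<Longrightarrow> x \<in> S \<and> (adjacent \<mu> x y \<longrightarrow> y \<in> S)"
    and lip: "\<And>x y. \<bar>\<phi> x - \<phi> y\<bar> \<le> L * \<rho> x y"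
    and B: "B \<subseteq> S" "\<And>x. x \<in> B \<Longrightarrow> \<phi> x = 1"
  shows caccioppoli: "energy B \<le> 4 * (2 / min 1 (p - 1) * (L\<^sup>2 * mass S))"
    and annulus: "0 < t \<Longrightarrow> energy B
        \<le> t * (energy S - energy B) + (2 / min 1 (p - 1) * (L\<^sup>2 * mass S)) / t"
proof -
  let ?e = "\<lambda>x y. energy_density x y"
  define I where "I x y = (of_bool (x \<in> B \<and> y \<in> B) :: real)" for x y
  note estimate = cutoff_estimate[of S D \<phi> L, OF deg mass \<phi> supp lip]
  note e_S = energy_summable[of S D, OF deg mass]
  have e_B: "(\<lambda>(x, y). ?e x y) summable_on B \<times> B"
    by (rule summable_on_subset_banach[OF e_S]) (use B in auto)
  have I: "((\<lambda>(x, y). ?e x y * I x y) has_sum energy B) (S \<times> S)"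
    using has_sum_infsum[OF e_B] unfolding powr_energy_def
    by (subst has_sum_cong_neutral[where g = "\<lambda>(x, y). ?e x y" and T = "B \<times> B"])
      (use B in \<open>auto simp: I_def\<close>)
  have sq: "(\<phi> x)\<^sup>2 \<le> 1" for x
    using \<phi>[of x] by (simp add: power_le_one)
  have "(\<Sum>\<^sub>\<infinity>(x, y)\<in>S \<times> S. ?e x y * I x y)
      \<le> 4 / (min 1 (p - 1) * (1 / 2)) * (L\<^sup>2 * mass S)"
  proof (rule estimate)
    show "(\<lambda>(x, y). ?e x y * I x y) summable_on S \<times> S"
      using I by (rule has_sum_imp_summable)
    show "?e x y * I x y
        \<le> ?e x y * (((\<phi> x)\<^sup>2 + (\<phi> y)\<^sup>2) * (1 - 1 / 2 * of_bool (\<phi> x \<noteq> \<phi> y)))" for x y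
      using B by (intro mult_left_mono energy_density_nonneg) (auto simp: I_def)
  qed auto
  then show "energy B \<le> 4 * (2 / min 1 (p - 1) * (L\<^sup>2 * mass S))"
    unfolding infsumI[OF I] by (simp add: field_simps)
  assume t: "0 < t"
  have J: "((\<lambda>(x, y). 2 * (1 + t) * (?e x y * I x y) - 2 * t * ?e x y) has_sum
      2 * (1 + t) * energy B - 2 * t * energy S) (S \<times> S)"
  proof -
    have "((\<lambda>z. 2 * (1 + t) * (case z of (x, y) \<Rightarrow> ?e x y * I x y)
        + (- 2 * t) * (case z of (x, y) \<Rightarrow> ?e x y)) has_sum
        2 * (1 + t) * energy B + (- 2 * t) * energy S) (S \<times> S)"
      unfolding powr_energy_def[of _ _ _ S]
      by (intro has_sum_add has_sum_cmult_right I has_sum_infsum e_S)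
    then show ?thesis by (simp add: case_prod_unfold)
  qed
  have "(\<Sum>\<^sub>\<infinity>(x, y)\<in>S \<times> S. 2 * (1 + t) * (?e x y * I x y) - 2 * t * ?e x y)
      \<le> 4 / (min 1 (p - 1) * t) * (L\<^sup>2 * mass S)"
  proof (rule estimate)
    show "(\<lambda>(x, y). 2 * (1 + t) * (?e x y * I x y) - 2 * t * ?e x y) summable_on S \<times> S"
      using J by (rule has_sum_imp_summable)
    show "2 * (1 + t) * (?e x y * I x y) - 2 * t * ?e x y
        \<le> ?e x y * (((\<phi> x)\<^sup>2 + (\<phi> y)\<^sup>2) * (1 - t * of_bool (\<phi> x \<noteq> \<phi> y)))" for x y
    proof -
      have "2 * (1 + t) * I x y - 2 * t
          \<le> ((\<phi> x)\<^sup>2 + (\<phi> y)\<^sup>2) * (1 - t * of_bool (\<phi> x \<noteq> \<phi> y))"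
      proof (cases "x \<in> B \<and> y \<in> B")
        case True
        then show ?thesis using B by (simp add: I_def)
      next
        case False
        have "t * ((\<phi> x)\<^sup>2 + (\<phi> y)\<^sup>2) \<le> t * 2"
          using sq[of x] sq[of y] t by (intro mult_left_mono) auto
        moreover have "0 \<le> (\<phi> x)\<^sup>2 + (\<phi> y)\<^sup>2" by simp
        moreover have "((\<phi> x)\<^sup>2 + (\<phi> y)\<^sup>2) * (1 - t)
            \<le> ((\<phi> x)\<^sup>2 + (\<phi> y)\<^sup>2) * (1 - t * of_bool (\<phi> x \<noteq> \<phi> y))"
          using t by (intro mult_left_mono) auto
        moreover have "((\<phi> x)\<^sup>2 + (\<phi> y)\<^sup>2) * (1 - t)
            = (\<phi> x)\<^sup>2 + (\<phi> y)\<^sup>2 - t * ((\<phi> x)\<^sup>2 + (\<phi> y)\<^sup>2)"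
          by (simp add: algebra_simps)
        moreover have "2 * (1 + t) * I x y = 0" using False by (simp add: I_def)
        ultimately show ?thesis by linarith
      qed
      from mult_left_mono[OF this energy_density_nonneg[of x y]] show ?thesis
        by (simp add: algebra_simps)
    qed
  qed (use t in auto)
  then have "2 * (1 + t) * energy B - 2 * t * energy S
      \<le> 2 * ((2 / min 1 (p - 1) * (L\<^sup>2 * mass S)) / t)"
    unfolding infsumI[OF J] by (simp add: field_simps)
  then show "energy B
      \<le> t * (energy S - energy B) + (2 / min 1 (p - 1) * (L\<^sup>2 * mass S)) / t"
    by (simp add: algebra_simps)
qed

text \<open>The cutoff is \<open>1\<close> on the ball of radius \<open>r\<close>, decreases with slope \<open>2 / r\<close>, and vanishes from radius
  \<open>3 r / 2\<close> on. The remaining width \<open>r / 2\<close> is at least the jump size, so that neighbours of its support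
  still lie in the ball of radius \<open>2 r\<close>.\<close>

lemma dyadic_energy_estimate:
  assumes deg: "\<And>x. x \<in> dist_ball \<rho> x0 (2 * r) \<Longrightarrow> weighted_degree m \<mu> x \<le> D"
    and mass: "(\<lambda>x. m x * f x powr p) summable_on dist_ball \<rho> x0 (2 * r)"
    and r: "0 < r" and jump: "\<And>x y. adjacent \<mu> x y \<Longrightarrow> \<rho> x y \<le> r / 2"
    and pos: "0 < energy (dist_ball \<rho> x0 r)"
  shows "r\<^sup>2 \<le> 64 / min 1 (p - 1) * mass (dist_ball \<rho> x0 (2 * r)) *
      (1 / energy (dist_ball \<rho> x0 r) - 1 / energy (dist_ball \<rho> x0 (2 * r)))"
proof -
  let ?B = "dist_ball \<rho> x0 r" and ?S = "dist_ball \<rho> x0 (2 * r)"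
  define \<phi> where "\<phi> x = max 0 (min 1 (3 - 2 * \<rho> x x0 / r))" for x
  define M where "M = 2 / min 1 (p - 1) * ((2 / r)\<^sup>2 * power_mass m p f ?S)"
  have tri: "\<rho> x z \<le> \<rho> x y + \<rho> y z" and sym: "\<rho> x y = \<rho> y x" for x y z
    using metric by (auto simp: pseudo_metric_def)
  have lip: "\<bar>\<phi> x - \<phi> y\<bar> \<le> 2 / r * \<rho> x y" for x y
  proof -
    have "\<bar>\<phi> x - \<phi> y\<bar> \<le> \<bar>2 * \<rho> x x0 / r - 2 * \<rho> y x0 / r\<bar>"
      by (auto simp: \<phi>_def)
    also have "2 * \<rho> x x0 / r - 2 * \<rho> y x0 / r = 2 / r * (\<rho> x x0 - \<rho> y x0)"
      by (simp add: diff_divide_distrib right_diff_distrib)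
    also have "\<bar>\<dots>\<bar> = 2 / r * \<bar>\<rho> x x0 - \<rho> y x0\<bar>"
      using r by (simp only: abs_mult) simp
    also have "\<dots> \<le> 2 / r * \<rho> x y"
      using tri[of x x0 y] tri[of y x0 x] sym[of x y] r by (intro mult_left_mono) auto
    finally show ?thesis .
  qed
  have supp: "x \<in> ?S \<and> (adjacent \<mu> x y \<longrightarrow> y \<in> ?S)" if "\<phi> x \<noteq> 0" for x y
  proof -
    have "0 < 3 - 2 * \<rho> x x0 / r"
      using that by (auto simp: \<phi>_def max_def split: if_splits)
    then have "\<rho> x x0 < 3 / 2 * r" using r by (simp add: field_simps)
    then show ?thesis
      using jump[of x y] tri[of y x0 x] sym[of x y] r by (auto simp: dist_ball_def)
  qed
  have sub: "?B \<subseteq> ?S" using r by (auto simp: dist_ball_def)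
  have one: "\<phi> x = 1" if "x \<in> ?B" for x
  proof -
    have "2 * \<rho> x x0 / r \<le> 2" using that r by (simp add: dist_ball_def field_simps)
    then show ?thesis by (simp add: \<phi>_def)
  qed
  have \<phi>: "0 \<le> \<phi> x" "\<phi> x \<le> 1" for x by (auto simp: \<phi>_def)
  have "1 \<le> 8 * M * (1 / energy ?B - 1 / energy ?S)"
  proof (rule reciprocal_gap_of_interpolation[OF pos])
    show "energy ?B \<le> energy ?S"
      by (intro energy_mono[OF energy_summable[of _ D]] deg mass sub)
    show "energy ?B \<le> 4 * M"
      unfolding M_def
      by (rule caccioppoli[of ?S D \<phi> "2 / r"]) (use deg mass \<phi> supp lip sub one in auto)
    show "energy ?B \<le> t * (energy ?S - energy ?B) + M / t" if "0 < t" for t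
      unfolding M_def
      by (rule annulus[of ?S D \<phi> "2 / r"]) (use deg mass \<phi> supp lip sub one that in auto)
  qed
  then have "r\<^sup>2 * 1 \<le> r\<^sup>2 * (8 * M * (1 / energy ?B - 1 / energy ?S))"
    by (intro mult_left_mono) auto
  also have "r\<^sup>2 * (8 * M * (1 / energy ?B - 1 / energy ?S)) =
      64 / min 1 (p - 1) * power_mass m p f ?S * (1 / energy ?B - 1 / energy ?S)"
    using r by (simp add: M_def power_divide)
  finally show ?thesis by simp
qed

end

text \<open>The dyadic energy estimate bounds each summand by a difference of reciprocal energies, and these
  differences telescope.\<close>

lemma (in subharmonic_on_graph) weighted_radii_sum_bounded:
  assumes deg: "\<And>r. bounded (weighted_degree m \<mu> ` dist_ball \<rho> x0 r)"
    and mass: "\<And>r. (\<lambda>x. m x * f x powr p) summable_on dist_ball \<rho> x0 r"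
    and R: "0 < R" and jump: "\<And>x y. adjacent \<mu> x y \<Longrightarrow> \<rho> x y \<le> R / 2"
    and pos: "0 < energy (dist_ball \<rho> x0 R)"
  shows "(\<Sum>j<n. (2 ^ j * R)\<^sup>2 / mass (dist_ball \<rho> x0 (2 * (2 ^ j * R))))
      \<le> 64 / min 1 (p - 1) / energy (dist_ball \<rho> x0 R)"
    and "0 < mass (dist_ball \<rho> x0 (2 * R))"
proof -
  define E where "E r = energy (dist_ball \<rho> x0 r)" for r
  define v where "v r = mass (dist_ball \<rho> x0 r)" for r
  define c where "c j = 2 ^ j * R" for j :: nat
  define K where "K = 64 / min 1 (p - 1)"
  have K: "0 < K" using p by (simp add: K_def)
  have c_pos: "0 < c j" and c_ge: "R \<le> c j" and c_Suc: "c (Suc j) = 2 * c j" for j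
    using R by (simp_all add: c_def)
  have degb: "\<exists>D. \<forall>x \<in> dist_ball \<rho> x0 r. weighted_degree m \<mu> x \<le> D" for r
    using deg[of r] by (auto simp: bounded_iff abs_le_iff)
  have E_mono: "E r \<le> E s" if "r \<le> s" for r s
  proof -
    obtain D where "\<And>x. x \<in> dist_ball \<rho> x0 s \<Longrightarrow> weighted_degree m \<mu> x \<le> D"
      using degb[of s] by blast
    then show ?thesis
      unfolding E_def using that
      by (intro energy_mono[OF energy_summable[of _ D]] mass) (auto simp: dist_ball_def)
  qed
  have E_pos: "0 < E r" if "R \<le> r" for r
    using pos E_mono[OF that] by (simp add: E_def)
  have v_nonneg: "0 \<le> v r" for r
    unfolding v_def power_mass_def
    by (intro infsum_nonneg mult_nonneg_nonneg) (auto simp: m_pos less_imp_le)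
  have step: "(c j)\<^sup>2 \<le> K * v (2 * c j) * (1 / E (c j) - 1 / E (2 * c j))" for j
  proof -
    obtain D where D: "\<And>x. x \<in> dist_ball \<rho> x0 (2 * c j) \<Longrightarrow> weighted_degree m \<mu> x \<le> D"
      using degb[of "2 * c j"] by blast
    show ?thesis
      unfolding K_def v_def E_def
    proof (rule dyadic_energy_estimate[OF D mass c_pos])
      show "\<rho> x y \<le> c j / 2" if "adjacent \<mu> x y" for x y
        using jump[OF that] c_ge[of j] by linarith
      show "0 < energy (dist_ball \<rho> x0 (c j))"
        using E_pos[OF c_ge] by (simp add: E_def)
    qed
  qed
  have v_pos: "0 < v (2 * c j)" for j
  proof (rule ccontr)
    assume "\<not> 0 < v (2 * c j)"
    then have "v (2 * c j) = 0" using v_nonneg[of "2 * c j"] by simp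
    then have "(c j)\<^sup>2 \<le> 0" using step[of j] by simp
    then show False using c_pos[of j] by simp
  qed
  have "(\<Sum>j<n. (c j)\<^sup>2 / v (2 * c j)) \<le> (\<Sum>j<n. K * (1 / E (c j) - 1 / E (c (Suc j))))"
  proof (rule sum_mono)
    show "(c j)\<^sup>2 / v (2 * c j) \<le> K * (1 / E (c j) - 1 / E (c (Suc j)))" for j
      using step[of j] v_pos[of j] by (simp add: c_Suc pos_divide_le_eq mult_ac)
  qed
  also have "\<dots> = K * (1 / E (c 0) - 1 / E (c n))"
    using sum_lessThan_telescope'[of "\<lambda>j. 1 / E (c j)" n] by (simp flip: sum_distrib_left)
  also have "\<dots> \<le> K * (1 / E (c 0))"
    using K E_pos[OF c_ge[of n]] by (intro mult_left_mono) auto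
  finally show "(\<Sum>j<n. (2 ^ j * R)\<^sup>2 / mass (dist_ball \<rho> x0 (2 * (2 ^ j * R))))
      \<le> 64 / min 1 (p - 1) / energy (dist_ball \<rho> x0 R)"
    by (simp add: c_def v_def E_def K_def)
  show "0 < mass (dist_ball \<rho> x0 (2 * R))"
    using v_pos[of 0] by (simp add: v_def c_def)
qed

lemma (in subharmonic_on_graph) energy_pos:
  assumes deg: "\<And>x. x \<in> S \<Longrightarrow> weighted_degree m \<mu> x \<le> D"
    and mass: "(\<lambda>x. m x * f x powr p) summable_on S"
    and xy: "x \<in> S" "y \<in> S" "adjacent \<mu> x y" "f x \<noteq> f y"
  shows "0 < energy S"
proof -
  have "0 < energy_density x y"
    using xy powr_form_pos[OF p f_nonneg f_nonneg] by (simp add: adjacent_def)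
  also have "\<dots> = (\<Sum>\<^sub>\<infinity>(x, y)\<in>{(x, y)}. energy_density x y)"
    by simp
  also have "\<dots> \<le> energy S"
    unfolding powr_energy_def
    using xy by (intro infsum_mono2 energy_summable[OF deg mass]) (auto intro: energy_density_nonneg)
  finally show ?thesis .
qed

section \<open>Integrals over radii and over vertices\<close>

text \<open>On the dyadic interval \<open>[c, 2 c)\<close> the integrand is at most \<open>2 c / w c\<close> by monotonicity, and the
  interval has length \<open>c\<close>.\<close>

lemma nn_integral_dyadic_bound:
  fixes w :: "real \<Rightarrow> real"
  assumes R: "0 < R" and mono: "\<And>r s. r \<le> s \<Longrightarrow> w r \<le> w s" and pos: "\<And>r. R \<le> r \<Longrightarrow> 0 < w r"
    and sums: "\<And>n. (\<Sum>j<n. (2 ^ j * R)\<^sup>2 / w (2 ^ j * R)) \<le> C"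
  shows "(\<integral>\<^sup>+r \<in> {R..}. (ennreal r / ennreal (w r)) \<partial>lborel) \<le> ennreal (2 * C)"
proof -
  define c where "c j = 2 ^ j * R" for j :: nat
  have c_pos: "0 < c j" and c_Suc: "c (Suc j) = 2 * c j" and c_ge: "R \<le> c j" for j
    using R by (simp_all add: c_def)
  define step where "step j r = ennreal (c (Suc j) / w (c j)) * indicator {c j..<c (Suc j)} r"
    for j and r :: real
  have "(\<integral>\<^sup>+r \<in> {R..}. (ennreal r / ennreal (w r)) \<partial>lborel) \<le> (\<integral>\<^sup>+r. (\<Sum>j. step j r) \<partial>lborel)"
  proof (rule nn_integral_mono)
    fix r :: real
    show "ennreal r / ennreal (w r) * indicator {R..} r \<le> (\<Sum>j. step j r)"
    proof (cases "R \<le> r")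
      case True
      obtain n :: nat where n: "r / R < 2 ^ n"
        using real_arch_pow[of 2 "r / R"] by auto
      define k where "k = (LEAST n. r < c n)"
      have ex: "r < c n" using n R by (simp add: c_def field_simps)
      have k: "r < c k" unfolding k_def by (rule LeastI[of _ n]) (rule ex)
      have "k \<noteq> 0" using k True by (intro notI) (simp add: c_def)
      then obtain j where j: "k = Suc j" by (cases k) auto
      have "\<not> r < c j" using not_less_Least[of j "\<lambda>n. r < c n"] j by (simp add: k_def)
      then have r: "c j \<le> r" "r < c (Suc j)" using k j by auto
      have "ennreal r / ennreal (w r) = ennreal (r / w r)"
        using True R pos[of r] by (intro divide_ennreal) auto
      also have "\<dots> \<le> ennreal (c (Suc j) / w (c j))"
        using r True R pos[of r] pos[of "c j"] c_ge[of j] c_pos[of "Suc j"] mono[of "c j" r]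
        by (intro ennreal_leI frac_le) auto
      also have "\<dots> = step j r"
        using r by (simp add: step_def)
      also have "\<dots> \<le> (\<Sum>j. step j r)"
        using sum_le_suminf[of "\<lambda>j. step j r" "{j}"] by simp
      finally show ?thesis
        using True by simp
    qed auto
  qed
  also have "\<dots> = (\<Sum>j. \<integral>\<^sup>+r. step j r \<partial>lborel)"
    by (rule nn_integral_suminf) (simp add: step_def)
  also have "\<dots> = (\<Sum>j. ennreal (2 * ((c j)\<^sup>2 / w (c j))))"
  proof (rule suminf_cong)
    fix j
    have "(\<integral>\<^sup>+r. step j r \<partial>lborel) = ennreal (c (Suc j) / w (c j)) * ennreal (c (Suc j) - c j)"
      using c_pos[of j] by (simp add: step_def nn_integral_cmult_indicator c_Suc)
    also have "\<dots> = ennreal (2 * ((c j)\<^sup>2 / w (c j)))"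
      using c_pos[of j] pos[OF c_ge[of j]]
      by (simp add: c_Suc power2_eq_square flip: ennreal_mult)
    finally show "(\<integral>\<^sup>+r. step j r \<partial>lborel) = ennreal (2 * ((c j)\<^sup>2 / w (c j)))" .
  qed
  also have "\<dots> \<le> ennreal (2 * C)"
  proof (rule suminf_le_const)
    show "(\<Sum>j<n. ennreal (2 * ((c j)\<^sup>2 / w (c j)))) \<le> ennreal (2 * C)" for n
    proof -
      have "(\<Sum>j<n. ennreal (2 * ((c j)\<^sup>2 / w (c j)))) = ennreal (\<Sum>j<n. 2 * ((c j)\<^sup>2 / w (c j)))"
        using pos[OF c_ge] by (intro sum_ennreal) (simp add: less_imp_le)
      also have "\<dots> = ennreal (2 * (\<Sum>j<n. (c j)\<^sup>2 / w (c j)))"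
        by (simp add: sum_distrib_left)
      also have "\<dots> \<le> ennreal (2 * C)"
        using sums[of n] by (intro ennreal_leI) (simp add: c_def)
      finally show ?thesis .
    qed
  qed auto
  finally show ?thesis .
qed

lemma nn_integral_count_space_finite_imp_summable_on:
  fixes h :: "'a \<Rightarrow> real"
  assumes h: "\<And>x. 0 \<le> h x" and fin: "(\<integral>\<^sup>+x. ennreal (h x) \<partial>count_space A) \<noteq> \<infinity>"
  shows "h summable_on A"
    and "(\<integral>\<^sup>+x. ennreal (h x) \<partial>count_space A) = ennreal (\<Sum>\<^sub>\<infinity>x\<in>A. h x)"
proof -
  have "integrable (count_space A) h"
    by (rule integrableI_nonneg) (use assms in \<open>auto simp: top.not_eq_extremum\<close>)
  then have abs: "Infinite_Set_Sum.abs_summable_on h A"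
    by (simp add: Infinite_Set_Sum.abs_summable_on_def)
  then have "Infinite_Sum.abs_summable_on h A"
    by (simp only: abs_summable_equivalent)
  then show "h summable_on A"
    by (rule abs_summable_summable)
  show "(\<integral>\<^sup>+x. ennreal (h x) \<partial>count_space A) = ennreal (\<Sum>\<^sub>\<infinity>x\<in>A. h x)"
    using nn_integral_conv_infsetsum[OF abs h] infsetsum_infsum[OF abs] by simp
qed

lemma nn_integral_vertex_measure_indicator:
  fixes f :: "'a::countable \<Rightarrow> real"
  assumes m: "\<And>x. 0 \<le> m x" and f: "\<And>x. 0 \<le> f x"
  shows "(\<integral>\<^sup>+x. ennreal (\<bar>f x * indicator A x\<bar> powr p) \<partial>vertex_measure m)
    = (\<integral>\<^sup>+x. ennreal (m x * f x powr p) \<partial>count_space A)"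
proof -
  have "(\<integral>\<^sup>+x. ennreal (\<bar>f x * indicator A x\<bar> powr p) \<partial>vertex_measure m)
      = (\<integral>\<^sup>+x. ennreal (m x) * ennreal (\<bar>f x * indicator A x\<bar> powr p) \<partial>count_space UNIV)"
    by (simp add: vertex_measure_def point_measure_def nn_integral_density)
  also have "\<dots> = (\<integral>\<^sup>+x. ennreal (m x * f x powr p) * indicator A x \<partial>count_space UNIV)"
    using f m by (intro nn_integral_cong) (auto simp: indicator_def ennreal_mult)
  also have "\<dots> = (\<integral>\<^sup>+x. ennreal (m x * f x powr p) \<partial>count_space A)"
    by (simp add: nn_integral_count_space_indicator)
  finally show ?thesis .
qed

section \<open>The Liouville theorem\<close>

lemma constant_if_constant_on_edges:
  assumes conn: "connected_graph \<mu>" and edge: "\<And>x y. adjacent \<mu> x y \<Longrightarrow> f x = f y"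
  shows "f constant_on UNIV"
proof -
  have "f x = f y" for x y
  proof -
    have "(adjacent \<mu>)\<^sup>*\<^sup>* x y" using conn by (simp add: connected_graph_def)
    then show ?thesis by induction (auto dest: edge)
  qed
  then show ?thesis by (auto simp: constant_on_def)
qed

theorem theorem1p1:
  fixes m :: "'a::countable \<Rightarrow> real" and \<mu> :: "'a \<Rightarrow> 'a \<Rightarrow> real"
    and \<rho> :: "'a \<Rightarrow> 'a \<Rightarrow> real" and x0 :: 'a
    and f :: "'a \<Rightarrow> real" and p :: real
  assumes "weighted_graph m \<mu>"
    and "connected_graph \<mu>"
    and "pseudo_metric \<rho>" and "intrinsic m \<mu> \<rho>" and "compatible m \<mu> x0 \<rho>"
    and "\<And>x. 0 \<le> f x"
    and "subharmonic m \<mu> f"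
    and "1 < p"
    and "(INF r0 \<in> {0<..}. \<integral>\<^sup>+r \<in> {r0..}.
            (ennreal r / ennreal_powr
               (Lp_norm p (vertex_measure m) (\<lambda>x. f x * indicator (dist_ball \<rho> x0 r) x)) p)
            \<partial>lborel) = \<infinity>"
  shows "f constant_on UNIV"
proof -
  interpret weighted_graph m \<mu> by fact
  interpret subharmonic_on_graph m \<mu> \<rho> f p
    by unfold_locales (use assms in auto)
  let ?B = "dist_ball \<rho> x0"
  define V where "V r = (\<integral>\<^sup>+x. ennreal (m x * f x powr p) \<partial>count_space (?B r))" for r
  have norm_eq: "ennreal_powr (Lp_norm p (vertex_measure m) (\<lambda>x. f x * indicator (?B r) x)) p = V r" for r
    using p nn_integral_vertex_measure_indicator[of m f "?B r" p] f_nonneg m_pos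
    by (simp add: Lp_norm_powr less_imp_le V_def)
  have Inf: "(INF r0 \<in> {0<..}. \<integral>\<^sup>+r \<in> {r0..}. (ennreal r / V r) \<partial>lborel) = \<infinity>"
    using assms(9) unfolding norm_eq .
  have infinite: "(\<integral>\<^sup>+r \<in> {r0..}. (ennreal r / V r) \<partial>lborel) = \<infinity>" if "0 < r0" for r0
  proof -
    have "\<infinity> \<le> (\<integral>\<^sup>+r \<in> {r0..}. (ennreal r / V r) \<partial>lborel)"
      unfolding Inf[symmetric] using that by (intro INF_lower) simp
    then show ?thesis by (simp add: top_unique infinity_ennreal_def)
  qed
  have V_mono: "V r \<le> V s" if "r \<le> s" for r s
    using that unfolding V_def
    by (auto simp: nn_integral_count_space_indicator dist_ball_def split: split_indicator
        intro!: nn_integral_mono)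
  \<comment> \<open>If one ball had infinite mass, so would all larger ones, and the integrand would vanish eventually.\<close>
  have V_finite: "V R \<noteq> \<infinity>" for R
  proof
    assume V: "V R = \<infinity>"
    have "V r = \<infinity>" if "max 1 R \<le> r" for r
      using V_mono[of R r] that V by (simp add: top_unique infinity_ennreal_def)
    then have "(\<integral>\<^sup>+r \<in> {max 1 R..}. (ennreal r / V r) \<partial>lborel) = (\<integral>\<^sup>+(r::real). 0 \<partial>lborel)"
      by (intro nn_integral_cong) (auto simp: indicator_def)
    then show False using infinite[of "max 1 R"] by simp
  qed
  have term_nonneg: "0 \<le> m x * f x powr p" for x
    using m_pos[of x] by simp
  have summable: "(\<lambda>x. m x * f x powr p) summable_on ?B r" for r
    using nn_integral_count_space_finite_imp_summable_on(1)[OF term_nonneg V_finite[unfolded V_def]] .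
  have V: "V r = ennreal (mass (?B r))" for r
    using nn_integral_count_space_finite_imp_summable_on(2)[OF term_nonneg V_finite[unfolded V_def]]
    by (simp add: V_def power_mass_def)
  have deg: "bounded (weighted_degree m \<mu> ` ?B r)" for r
  proof (rule bounded_subset)
    show "bounded (weighted_degree m \<mu> ` ?B (max 0 r))"
      using assms(5) by (simp add: compatible_def)
  qed (auto simp: dist_ball_def)
  define s where "s = enn2real (jump_size \<mu> \<rho>)"
  have jump: "\<rho> x y \<le> s" if "adjacent \<mu> x y" for x y
  proof -
    have "ennreal (\<rho> x y) \<le> jump_size \<mu> \<rho>"
      unfolding jump_size_def using that by (intro SUP_upper2[of "(x, y)"]) auto
    also have "\<dots> = ennreal s"
      using assms(5) by (simp add: s_def compatible_def)
    finally show ?thesis by (simp add: s_def)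
  qed
  show ?thesis
  proof (rule constant_if_constant_on_edges[OF assms(2)], rule ccontr)
    fix x y assume xy: "adjacent \<mu> x y" "f x \<noteq> f y"
    define R where "R = Max {1, 2 * s, \<rho> x x0, \<rho> y x0}"
    have R: "1 \<le> R" "2 * s \<le> R" "\<rho> x x0 \<le> R" "\<rho> y x0 \<le> R"
      by (simp_all add: R_def)
    obtain D where "\<And>z. z \<in> ?B R \<Longrightarrow> weighted_degree m \<mu> z \<le> D"
      using deg[of R] by (auto simp: bounded_iff abs_le_iff)
    then have pos: "0 < energy (?B R)"
      using R xy summable by (intro energy_pos[of _ D x y]) (auto simp: dist_ball_def)
    have half: "\<rho> u v \<le> R / 2" if "adjacent \<mu> u v" for u v
      using jump[OF that] R by simp
    define C where "C = 64 / min 1 (p - 1) / energy (?B R)"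
    note bounds = weighted_radii_sum_bounded[OF deg summable _ half pos]
    have mass_mono: "mass (?B r) \<le> mass (?B t)" if "r \<le> t" for r t
      unfolding power_mass_def using that term_nonneg
      by (intro infsum_mono2 summable) (auto simp: dist_ball_def)
    have "(\<integral>\<^sup>+r \<in> {2 * R..}. (ennreal r / ennreal (mass (?B r))) \<partial>lborel) \<le> ennreal (2 * (4 * C))"
    proof (rule nn_integral_dyadic_bound)
      show "0 < mass (?B r)" if "2 * R \<le> r" for r
        using bounds(2) mass_mono[OF that] R by simp
      show "(\<Sum>j<n. (2 ^ j * (2 * R))\<^sup>2 / mass (?B (2 ^ j * (2 * R)))) \<le> 4 * C" for n
      proof -
        have "(\<Sum>j<n. (2 ^ j * (2 * R))\<^sup>2 / mass (?B (2 ^ j * (2 * R))))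
            = 4 * (\<Sum>j<n. (2 ^ j * R)\<^sup>2 / mass (?B (2 * (2 ^ j * R))))"
          by (simp add: sum_distrib_left power_mult_distrib mult.left_commute)
        then show ?thesis using bounds(1)[of n] R by (simp add: C_def)
      qed
    qed (use R mass_mono in auto)
    then have "(\<integral>\<^sup>+r \<in> {2 * R..}. (ennreal r / V r) \<partial>lborel) < \<infinity>"
      unfolding V by (rule le_less_trans) simp
    then show False
      using infinite[of "2 * R"] R by simp
  qed
qed

end
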